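(* A group $G$ is supramenable if and only if $\operatorname{cr}(G)\le 1$.
   Context: Supramenable. A group $G$ is supramenable if no nonempty subset of $G$ is paradoxical. A subset $E\subseteq G$ is paradoxical if it contains two disjoint copies of itself obtained by finite partitions and left translations: i.e. there are finite partitions $E=P_1\sqcup\dots\sqcup P_m=Q_1\sqcup\dots\sqcup Q_n$ and elements $g_1,\dots,g_m,h_1,\dots,h_n\in G$ such that the sets $g_1P_1,\dots,g_mP_m,h_1Q_1,\dots,h_nQ_n$ are pairwise disjoint and contained in $E$. Collision rank. Let $G$ be a group. A label set in $G$ is a finite symmetric ($A=A^{-1}$) subset $A\subseteq G$ containing $1$. For $h\ge 1$ let $T_h$ be the complete rooted trivalent tree of height $h$: the root has three children, every other non-leaf vertex has two children, and all leaves are at distance $h$ from the root (so there are $3\cdot 2^{h-1}$ leaves). Two vertices are incomparable if neither lies on the geodesic path from the root to the other. For an edge labeling of $T_h$ by elements of $G$ and a vertex $v$, put $p(v)=a_k\cdots a_1\in G$, where $a_1,\dots,a_k$ are the ordered edge labels along the path from the root to $v$ (and $p(\text{root})=1$). For label sets $A,B\subseteq G$ write $A\Longrightarrow B$ if there is an integer $h\ge 1$ such that for every edge labeling of $T_h$ by elements of $A$ there exist two incomparable vertices $v,w$ with $p(v)\,p(w)^{-1}\in B$. The collision rank $\operatorname{cr}(G)$ is the least integer $r\ge 0$ such that every label set $A_0\subseteq G$ admits label sets $A_1,\dots,A_r\subseteq G$ with $A_0\Longrightarrow A_1\Longrightarrow\cdots\Longrightarrow A_r=\{1\}$ (for $r=0$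 this means $A_0=\{1\}$); if no such $r$ exists, $\operatorname{cr}(G)=\infty$. *)

theory Defs
  imports
    "HOL-Algebra.Coset"
    "HOL-Library.Disjoint_Sets"
    "HOL-Library.Extended_Nat"
    "HOL-Library.Sublist"
begin

text \<open>
  A finite partition of \<open>E\<close> is an indexed family \<open>P i\<close> (\<open>i < m\<close>) of pairwise disjoint, possibly
  empty sets with union \<open>E\<close>.
\<close>

definition fin_partition :: "'a set \<Rightarrow> nat \<Rightarrow> (nat \<Rightarrow> 'a set) \<Rightarrow> bool" where
  "fin_partition E m P \<longleftrightarrow> disjoint_family_on P {..<m} \<and> (\<Union>i<m. P i) = E"

definition paradoxical :: "('a, 'b) monoid_scheme \<Rightarrow> 'a set \<Rightarrow> bool" where
  "paradoxical G E \<longleftrightarrow>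
    (\<exists>m n P Q g h.
      fin_partition E m P \<and> fin_partition E n Q \<and>
      (\<forall>i<m. g i \<in> carrier G) \<and> (\<forall>j<n. h j \<in> carrier G) \<and>
      disjoint_family_on (\<lambda>i. g i <#\<^bsub>G\<^esub> P i) {..<m} \<and>
      disjoint_family_on (\<lambda>j. h j <#\<^bsub>G\<^esub> Q j) {..<n} \<and>
      (\<forall>i<m. \<forall>j<n. (g i <#\<^bsub>G\<^esub> P i) \<inter> (h j <#\<^bsub>G\<^esub> Q j) = {}) \<and>
      (\<forall>i<m. g i <#\<^bsub>G\<^esub> P i \<subseteq> E) \<and> (\<forall>j<n. h j <#\<^bsub>G\<^esub> Q j \<subseteq> E))"

definition supramenable :: "('a, 'b) monoid_scheme \<Rightarrow> bool" where
  "supramenable G \<longleftrightarrow> (\<forall>E. E \<subseteq> carrier G \<and> E \<noteq> {} \<longrightarrow> \<not> paradoxical G E)"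

definition label_set :: "('a, 'b) monoid_scheme \<Rightarrow> 'a set \<Rightarrow> bool" where
  "label_set G A \<longleftrightarrow>
    A \<subseteq> carrier G \<and> finite A \<and> set_inv\<^bsub>G\<^esub> A = A \<and> \<one>\<^bsub>G\<^esub> \<in> A"

text \<open>
  A vertex of the infinite rooted trivalent tree is encoded by the child numbers chosen along the
  path from the root, listed with the \<^emph>\<open>last\<close> choice first: the root is \<open>[]\<close> and the children of
  \<open>v\<close> are the \<open>i # v\<close>.  The vertices on the path from the root to \<open>v\<close> are thus the suffixes
  of \<open>v\<close>, and \<open>length v\<close> is the distance from the root.
\<close>

primrec trivalent_vertex :: "nat list \<Rightarrow> bool" where
  "trivalent_vertex [] \<longleftrightarrow> True"
| "trivalent_vertex (i # v) \<longleftrightarrow> i < (if v = [] then 3 else 2) \<and> trivalent_vertex v"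

definition tree_vertices :: "nat \<Rightarrow> nat list set" where
  "tree_vertices h = {v. trivalent_vertex v \<and> length v \<le> h}"

definition incomparable :: "nat list \<Rightarrow> nat list \<Rightarrow> bool" where
  "incomparable v w \<longleftrightarrow> \<not> suffix v w \<and> \<not> suffix w v"

text \<open>
  An edge is identified with its endpoint further from the root, so an edge labeling is a function
  on the non-root vertices: \<open>l (i # v)\<close> is the label of the edge from \<open>v\<close> to \<open>i # v\<close>.
\<close>

definition edge_labeling :: "nat \<Rightarrow> 'a set \<Rightarrow> (nat list \<Rightarrow> 'a) \<Rightarrow> bool" where
  "edge_labeling h A l \<longleftrightarrow> (\<forall>v \<in> tree_vertices h - {[]}. l v \<in> A)"

primrec path_product :: "('a, 'b) monoid_scheme \<Rightarrow> (nat list \<Rightarrow> 'a) \<Rightarrow> nat list \<Rightarrow> 'a" where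
  "path_product G l [] = \<one>\<^bsub>G\<^esub>"
| "path_product G l (i # v) = l (i # v) \<otimes>\<^bsub>G\<^esub> path_product G l v"

definition collides :: "('a, 'b) monoid_scheme \<Rightarrow> 'a set \<Rightarrow> 'a set \<Rightarrow> bool" where
  "collides G A B \<longleftrightarrow>
    (\<exists>h\<ge>1. \<forall>l. edge_labeling h A l \<longrightarrow>
      (\<exists>v \<in> tree_vertices h. \<exists>w \<in> tree_vertices h. incomparable v w \<and>
        path_product G l v \<otimes>\<^bsub>G\<^esub> inv\<^bsub>G\<^esub> (path_product G l w) \<in> B))"

definition collision_chains :: "('a, 'b) monoid_scheme \<Rightarrow> nat \<Rightarrow> bool" where
  "collision_chains G r \<longleftrightarrow>
    (\<forall>A\<^sub>0. label_set G A\<^sub>0 \<longrightarrow>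
      (\<exists>A. A 0 = A\<^sub>0 \<and> (\<forall>i\<le>r. label_set G (A i)) \<and>
        (\<forall>i<r. collides G (A i) (A (Suc i))) \<and> A r = {\<one>\<^bsub>G\<^esub>}))"

definition collision_rank :: "('a, 'b) monoid_scheme \<Rightarrow> enat" where
  "collision_rank G =
    (if \<exists>r. collision_chains G r then enat (LEAST r. collision_chains G r) else \<infinity>)"

end

theory Submission
  imports Defs "HOL-Library.Diagonal_Subsequence"
begin

text \<open>
  A collision rank of at most \<open>1\<close> means that every label set \<open>A\<close> satisfies \<open>A \<Longrightarrow> {1}\<close>
  (lemma \<open>collision_rank_le_1_iff\<close>).  Both this property and supramenability are shown to fail
  exactly when some label set \<open>A\<close> carries a \<^emph>\<open>free labeling\<close>: a labeling of the infinite
  trivalent tree by elements of \<open>A\<close> whose path products \<open>p\<close> never agree on incomparable vertices.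

  If \<open>A \<Longrightarrow> {1}\<close> fails, then every finite tree has a collision-free labeling by \<open>A\<close>; as \<open>A\<close> is
  finite, compactness yields a free labeling (\<open>collides_one_iff_no_free_labeling\<close>).

  A set \<open>E\<close> is paradoxical iff it has two injective self-maps \<open>f\<^sub>0, f\<^sub>1\<close> with disjoint images, each
  moving points only by left translations from a finite set (\<open>paradoxical_iff_doubling_maps\<close>).

  Given such maps, every \<open>x \<in> E\<close> has at most one of \<open>f\<^sub>0 x, f\<^sub>1 x\<close> fixed by a nonempty word in
  \<open>f\<^sub>0, f\<^sub>1\<close>.  At a point \<open>x\<^sub>0\<close> fixed by no nonempty word, distinct words have distinct values, and
  embedding the trivalent tree into the binary tree of words gives a free labeling
  (\<open>doubling_maps_imp_free_labeling\<close>).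

  Conversely, let a free labeling be given.  Each fibre of \<open>p\<close> is a chain.  Every vertex of a fibre
  over \<open>x\<close> has a child through which the chain does not pass; these children are pairwise
  incomparable and their path products lie in \<open>A x\<close>.  So fibres are finite, and each has a
  deepest vertex.  Starting at the root, jump to the deepest vertex of the current fibre and then step
  to one of two children, and repeat.  The vertices reached after jumps form a binary tree on which
  \<open>p\<close> is injective, and its image is paradoxical, since jumps do not change \<open>p\<close>
  (\<open>free_labeling_imp_doubling_maps\<close>).
\<close>

section \<open>Doubling maps and free labelings\<close>

text \<open>
  The two maps \<open>f 0\<close> and \<open>f 1\<close> are injective on \<open>E\<close>, have disjoint images inside \<open>E\<close>, and move each
  point by a left translation from the finite set \<open>B\<close>.  Values \<open>f i\<close> for \<open>i \<ge> 2\<close> are irrelevant.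
\<close>

definition doubling_maps ::
    "('a, 'b) monoid_scheme \<Rightarrow> 'a set \<Rightarrow> 'a set \<Rightarrow> (nat \<Rightarrow> 'a \<Rightarrow> 'a) \<Rightarrow> bool" where
  "doubling_maps G E B f \<longleftrightarrow>
    finite B \<and> B \<subseteq> carrier G \<and>
    (\<forall>x\<in>E. \<forall>i<2. f i x \<in> E \<and> (\<exists>b\<in>B. f i x = b \<otimes>\<^bsub>G\<^esub> x)) \<and>
    (\<forall>x\<in>E. \<forall>y\<in>E. \<forall>i<2. \<forall>j<2. f i x = f j y \<longrightarrow> i = j \<and> x = y)"

text \<open>
  A labeling by \<open>A\<close> of the infinite trivalent tree without collisions between incomparable vertices.
  Comparable vertices may have equal path products.
\<close>

definition free_labeling :: "('a, 'b) monoid_scheme \<Rightarrow> 'a set \<Rightarrow> (nat list \<Rightarrow> 'a) \<Rightarrow> bool" where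
  "free_labeling G A l \<longleftrightarrow>
    (\<forall>v. trivalent_vertex v \<and> v \<noteq> [] \<longrightarrow> l v \<in> A) \<and>
    (\<forall>v w. trivalent_vertex v \<and> trivalent_vertex w \<and> incomparable v w \<longrightarrow>
      path_product G l v \<noteq> path_product G l w)"

lemma doubling_maps_inj:
  "\<lbrakk>doubling_maps G E B f; x \<in> E; y \<in> E; i < 2; j < 2; f i x = f j y\<rbrakk> \<Longrightarrow> i = j \<and> x = y"
  unfolding doubling_maps_def by blast

lemma trivalent_vertex_suffix: "trivalent_vertex v \<Longrightarrow> suffix u v \<Longrightarrow> trivalent_vertex u"
proof -
  have "trivalent_vertex (d @ u) \<Longrightarrow> trivalent_vertex u" for d by (induction d) auto
  then show "trivalent_vertex v \<Longrightarrow> suffix u v \<Longrightarrow> trivalent_vertex u" by (auto simp: suffix_def)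
qed

lemma suffix_Cons_unique: "suffix (i # u) w \<Longrightarrow> suffix (j # u) w \<Longrightarrow> i = j"
  by (auto simp: suffix_def append_eq_append_conv2 append_eq_Cons_conv)

lemma path_product_cong:
  "(\<And>u. suffix u v \<Longrightarrow> u \<noteq> [] \<Longrightarrow> l u = l' u) \<Longrightarrow> path_product G l v = path_product G l' v"
proof (induction v)
  case (Cons i v)
  have "path_product G l v = path_product G l' v"
    using Cons by (intro Cons.IH) (auto intro: suffix_ConsI)
  then show ?case using Cons.prems[of "i # v"] by simp
qed simp

lemma path_product_closed:
  assumes "group G" "A \<subseteq> carrier G" "\<And>u. suffix u v \<Longrightarrow> u \<noteq> [] \<Longrightarrow> l u \<in> A"
  shows "path_product G l v \<in> carrier G"
  using assms(3)
proof (induction v)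
  case Nil
  then show ?case using assms(1) by (simp add: group.is_monoid)
next
  case (Cons i v)
  have "path_product G l v \<in> carrier G"
    using Cons by (intro Cons.IH) (auto intro: suffix_ConsI)
  moreover have "l (i # v) \<in> carrier G" using Cons.prems[of "i # v"] assms(2) by auto
  ultimately show ?case using assms(1) by (simp add: group.is_monoid monoid.m_closed)
qed

section \<open>Collision rank at most one\<close>

lemma label_set_one: "group G \<Longrightarrow> label_set G {\<one>\<^bsub>G\<^esub>}"
  by (auto simp: label_set_def SET_INV_def group.is_monoid group.is_group monoid.inv_one)

lemma collides_one_one:
  assumes "group G" shows "collides G {\<one>\<^bsub>G\<^esub>} {\<one>\<^bsub>G\<^esub>}"
proof -
  interpret group G by fact
  have "\<exists>v\<in>tree_vertices 1. \<exists>w\<in>tree_vertices 1. incomparable v w \<and>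
      path_product G l v \<otimes>\<^bsub>G\<^esub> inv\<^bsub>G\<^esub> path_product G l w \<in> {\<one>\<^bsub>G\<^esub>}"
    if "edge_labeling 1 {\<one>\<^bsub>G\<^esub>} l" for l
  proof -
    have v: "[0] \<in> tree_vertices 1" "[1] \<in> tree_vertices 1" by (auto simp: tree_vertices_def)
    then have "path_product G l [0] \<otimes>\<^bsub>G\<^esub> inv\<^bsub>G\<^esub> path_product G l [1] \<in> {\<one>\<^bsub>G\<^esub>}"
      using that by (auto simp: edge_labeling_def)
    moreover have "incomparable [0] [1]" by (auto simp: incomparable_def suffix_Cons)
    ultimately show ?thesis using v by blast
  qed
  then show ?thesis by (auto simp: collides_def)
qed

lemma collision_chains_1_iff:
  assumes "group G"
  shows "collision_chains G 1 \<longleftrightarrow> (\<forall>A. label_set G A \<longrightarrow> collides G A {\<one>\<^bsub>G\<^esub>})"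
proof
  assume "collision_chains G 1"
  then show "\<forall>A. label_set G A \<longrightarrow> collides G A {\<one>\<^bsub>G\<^esub>}"
    unfolding collision_chains_def by (metis One_nat_def lessI)
next
  assume *: "\<forall>A. label_set G A \<longrightarrow> collides G A {\<one>\<^bsub>G\<^esub>}"
  show "collision_chains G 1"
    unfolding collision_chains_def
  proof (intro allI impI)
    fix A\<^sub>0 assume A0: "label_set G A\<^sub>0"
    define A where "A = (\<lambda>i::nat. if i = 0 then A\<^sub>0 else {\<one>\<^bsub>G\<^esub>})"
    show "\<exists>A. A 0 = A\<^sub>0 \<and> (\<forall>i\<le>1. label_set G (A i)) \<and>
        (\<forall>i<1. collides G (A i) (A (Suc i))) \<and> A 1 = {\<one>\<^bsub>G\<^esub>}"
      using A0 * label_set_one[OF assms] by (intro exI[of _ A]) (auto simp: A_def)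
  qed
qed

lemma collision_rank_le_1_iff:
  assumes "group G"
  shows "collision_rank G \<le> 1 \<longleftrightarrow> (\<forall>A. label_set G A \<longrightarrow> collides G A {\<one>\<^bsub>G\<^esub>})"
proof -
  have 0: "collision_chains G 1" if "collision_chains G 0"
    unfolding collision_chains_1_iff[OF assms]
    using that collides_one_one[OF assms] by (auto simp: collision_chains_def)
  have "collision_rank G \<le> 1 \<longleftrightarrow> collision_chains G 1"
  proof
    assume le: "collision_rank G \<le> 1"
    then obtain r where "collision_chains G r"
      by (auto simp: collision_rank_def split: if_splits)
    then have "collision_chains G (LEAST r. collision_chains G r)" by (rule LeastI)
    moreover have "(LEAST r. collision_chains G r) \<le> 1"
      using le by (auto simp: collision_rank_def one_enat_def split: if_splits)
    ultimately show "collision_chains G 1" using 0 by (auto simp: le_Suc_eq)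
  qed (auto simp: collision_rank_def one_enat_def intro: Least_le)
  then show ?thesis using collision_chains_1_iff[OF assms] by simp
qed

section \<open>Compactness\<close>

text \<open>
  Labels are made eventually constant at every vertex simultaneously by a diagonal subsequence.
\<close>

lemma labelings_converge:
  fixes L :: "nat \<Rightarrow> nat list \<Rightarrow> 'a"
  assumes "finite A" and "\<And>h v. L h v \<in> A"
  obtains r l where "strict_mono (r :: nat \<Rightarrow> nat)"
    and "\<And>v. eventually (\<lambda>k. L (r k) v = l v) sequentially"
proof -
  define P :: "nat \<Rightarrow> (nat \<Rightarrow> nat) \<Rightarrow> bool" where "P = (\<lambda>n s. \<exists>a. \<forall>k. L (s k) (from_nat n) = a)"
  interpret subseqs P
  proof
    fix n :: nat and s :: "nat \<Rightarrow> nat"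
    assume "strict_mono s"
    have "finite ((\<lambda>k. L (s k) (from_nat n)) ` UNIV)"
      by (rule finite_subset[OF _ assms(1)]) (use assms(2) in auto)
    then obtain k0 where "infinite {k \<in> UNIV. L (s k) (from_nat n) = L (s k0) (from_nat n)}"
      using pigeonhole_infinite[of "UNIV :: nat set" "\<lambda>k. L (s k) (from_nat n)"] by auto
    then have "infinite {k. L (s k) (from_nat n) = L (s k0) (from_nat n)}" by simp
    from infinite_enumerate[OF this] obtain r' :: "nat \<Rightarrow> nat" where "strict_mono r'"
      and "\<forall>k. r' k \<in> {k. L (s k) (from_nat n) = L (s k0) (from_nat n)}"
      by blast
    then show "\<exists>r'. strict_mono r' \<and> P n (s \<circ> r')" by (auto simp: P_def)
  qed
  have "\<exists>a. eventually (\<lambda>k. L (diagseq k) v = a) sequentially" for v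
  proof -
    define n where "n = to_nat v"
    have "P n (diagseq \<circ> ((+) (Suc n)))"
      by (rule diagseq_holds) (auto simp: P_def)
    then obtain a where a: "L (diagseq (Suc n + k)) v = a" for k by (auto simp: P_def n_def)
    have "L (diagseq k) v = a" if "k \<ge> Suc n" for k
      using a[of "k - Suc n"] that by simp
    then show ?thesis by (auto simp: eventually_sequentially)
  qed
  then obtain l where "\<And>v. eventually (\<lambda>k. L (diagseq k) v = l v) sequentially" by metis
  with subseq_diagseq show thesis by (rule that)
qed

lemma collides_one_iff_no_free_labeling:
  assumes "group G" and A: "label_set G A"
  shows "collides G A {\<one>\<^bsub>G\<^esub>} \<longleftrightarrow> (\<nexists>l. free_labeling G A l)"
proof -
  interpret group G by fact
  have fin: "finite A" and sub: "A \<subseteq> carrier G" and one: "\<one>\<^bsub>G\<^esub> \<in> A"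
    using A by (auto simp: label_set_def)
  have collision_iff: "path_product G l v \<otimes>\<^bsub>G\<^esub> inv\<^bsub>G\<^esub> path_product G l w \<in> {\<one>\<^bsub>G\<^esub>} \<longleftrightarrow>
      path_product G l v = path_product G l w"
    if "edge_labeling h A l" "v \<in> tree_vertices h" "w \<in> tree_vertices h" for h l v w
  proof -
    have "path_product G l u \<in> carrier G" if "u \<in> tree_vertices h" for u
    proof (rule path_product_closed[OF assms(1) sub])
      fix u' assume "suffix u' u" "u' \<noteq> []"
      then show "l u' \<in> A"
        using that \<open>edge_labeling h A l\<close> suffix_length_le[of u' u]
        by (auto simp: edge_labeling_def tree_vertices_def intro: trivalent_vertex_suffix)
    qed
    with that show ?thesis using inv_equality[of "path_product G l v" "inv\<^bsub>G\<^esub> (path_product G l w)"] by auto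
  qed
  show ?thesis
  proof
    assume "collides G A {\<one>\<^bsub>G\<^esub>}"
    then obtain h where h: "\<And>l. edge_labeling h A l \<Longrightarrow>
        \<exists>v\<in>tree_vertices h. \<exists>w\<in>tree_vertices h. incomparable v w \<and>
          path_product G l v \<otimes>\<^bsub>G\<^esub> inv\<^bsub>G\<^esub> path_product G l w \<in> {\<one>\<^bsub>G\<^esub>}"
      by (auto simp: collides_def)
    show "\<nexists>l. free_labeling G A l"
    proof
      assume "\<exists>l. free_labeling G A l"
      then obtain l where l: "free_labeling G A l" ..
      then have "edge_labeling h A l"
        by (auto simp: edge_labeling_def free_labeling_def tree_vertices_def)
      from h[OF this] collision_iff[OF this] l show False
        unfolding free_labeling_def tree_vertices_def by blast
    qed
  next
    assume none: "\<nexists>l. free_labeling G A l"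
    show "collides G A {\<one>\<^bsub>G\<^esub>}"
    proof (rule ccontr)
      assume "\<not> collides G A {\<one>\<^bsub>G\<^esub>}"
      then have "\<forall>h. \<exists>l. edge_labeling (Suc h) A l \<and>
          (\<forall>v\<in>tree_vertices (Suc h). \<forall>w\<in>tree_vertices (Suc h). incomparable v w \<longrightarrow>
            path_product G l v \<noteq> path_product G l w)"
      proof (intro allI)
        fix h
        from \<open>\<not> collides G A {\<one>\<^bsub>G\<^esub>}\<close> obtain l where l: "edge_labeling (Suc h) A l"
          and ne: "\<And>v w. \<lbrakk>v \<in> tree_vertices (Suc h); w \<in> tree_vertices (Suc h); incomparable v w\<rbrakk> \<Longrightarrow>
            path_product G l v \<otimes>\<^bsub>G\<^esub> inv\<^bsub>G\<^esub> path_product G l w \<notin> {\<one>\<^bsub>G\<^esub>}"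
          unfolding collides_def using Suc_le_mono[of 0 h] One_nat_def by (metis le0)
        show "\<exists>l. edge_labeling (Suc h) A l \<and>
          (\<forall>v\<in>tree_vertices (Suc h). \<forall>w\<in>tree_vertices (Suc h). incomparable v w \<longrightarrow>
            path_product G l v \<noteq> path_product G l w)"
          using l ne collision_iff[OF l] by blast
      qed
      then obtain L where L: "\<And>h. edge_labeling (Suc h) A (L h)"
        and free: "\<And>h v w. \<lbrakk>v \<in> tree_vertices (Suc h); w \<in> tree_vertices (Suc h); incomparable v w\<rbrakk>
            \<Longrightarrow> path_product G (L h) v \<noteq> path_product G (L h) w"
        by metis
      \<comment> \<open>Off the finite tree the label is \<open>1 \<in> A\<close>, so that all labelings take values in \<open>A\<close>.\<close>
      define L' where
        "L' = (\<lambda>h v. if v \<in> tree_vertices (Suc h) - {[]} then L h v else \<one>\<^bsub>G\<^esub>)"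
      have L'A: "L' h v \<in> A" for h v
        using L[of h] one by (auto simp: L'_def edge_labeling_def)
      obtain r l where r: "strict_mono (r :: nat \<Rightarrow> nat)"
        and lim: "\<And>v. eventually (\<lambda>k. L' (r k) v = l v) sequentially"
        by (rule labelings_converge[of A L', OF fin L'A]) (rule that)
      have lA: "l v \<in> A" for v
      proof -
        obtain k where "L' (r k) v = l v"
          using lim[of v] by (auto simp: eventually_sequentially)
        then show ?thesis using L'A by metis
      qed
      have agree: "eventually (\<lambda>k. v \<in> tree_vertices (Suc (r k)) \<and>
          path_product G (L (r k)) v = path_product G l v) sequentially"
        if v: "trivalent_vertex v" for v
      proof -
        have "eventually (\<lambda>k. \<forall>u\<in>{u. suffix u v}. L' (r k) u = l u) sequentially"
          using lim by (intro eventually_ball_finite) (auto simp flip: set_suffixes_eq)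
        moreover have "eventually (\<lambda>k. k \<ge> length v) sequentially"
          by (rule eventually_ge_at_top)
        ultimately show ?thesis
        proof eventually_elim
          case (elim k)
          have "length v \<le> r k" using elim(2) seq_suble[OF r, of k] by simp
          then have "u \<in> tree_vertices (Suc (r k))" if "suffix u v" for u
            using that v suffix_length_le[OF that] trivalent_vertex_suffix[OF v that]
            by (auto simp: tree_vertices_def)
          with elim(1) show ?case by (auto simp: L'_def intro!: path_product_cong split: if_splits)
        qed
      qed
      have "path_product G l v \<noteq> path_product G l w"
        if vw: "trivalent_vertex v" "trivalent_vertex w" "incomparable v w" for v w
      proof -
        obtain k where "v \<in> tree_vertices (Suc (r k))" "w \<in> tree_vertices (Suc (r k))"
          "path_product G (L (r k)) v = path_product G l v"
          "path_product G (L (r k)) w = path_product G l w"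
          using eventually_conj[OF agree[OF vw(1)] agree[OF vw(2)]]
          by (auto simp: eventually_sequentially)
        with free[of v "r k" w] vw(3) show ?thesis by metis
      qed
      with lA have "free_labeling G A l" unfolding free_labeling_def by blast
      with none show False by blast
    qed
  qed
qed

section \<open>Paradoxical sets and doubling maps\<close>

text \<open>
  One half of a paradoxical decomposition amounts to an injective self-map of \<open>E\<close> that moves points
  by finitely many translations.
\<close>

lemma (in group) pieces_imp_map:
  assumes E: "E \<subseteq> carrier G" and part: "fin_partition E m P"
    and g: "\<forall>i<m. g i \<in> carrier G"
    and disj: "disjoint_family_on (\<lambda>i. g i <# P i) {..<m}"
  obtains f where "\<And>x. x \<in> E \<Longrightarrow> \<exists>i<m. x \<in> P i \<and> f x = g i \<otimes> x" and "inj_on f E"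
proof -
  have "\<forall>x. \<exists>i. x \<in> E \<longrightarrow> i < m \<and> x \<in> P i"
    using part by (auto simp: fin_partition_def)
  then obtain c where c: "\<And>x. x \<in> E \<Longrightarrow> c x < m \<and> x \<in> P (c x)" by metis
  have "inj_on (\<lambda>x. g (c x) \<otimes> x) E"
  proof (rule inj_onI)
    fix x y assume xy: "x \<in> E" "y \<in> E" "g (c x) \<otimes> x = g (c y) \<otimes> y"
    have "g (c z) \<otimes> z \<in> g (c z) <# P (c z)" if "z \<in> E" for z
      using c[OF that] by (auto simp: l_coset_def)
    then have "c x = c y"
      using xy c disj by (auto simp: disjoint_family_on_def) (metis IntI emptyE lessThan_iff)
    moreover have "g (c y) \<in> carrier G" "x \<in> carrier G" "y \<in> carrier G"
      using xy c g E by auto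
    ultimately show "x = y" using xy(3) by simp
  qed
  with c show thesis by (intro that[of "\<lambda>x. g (c x) \<otimes> x"]) auto
qed

lemma (in group) map_imp_pieces:
  assumes E: "E \<subseteq> carrier G" and inj: "inj_on f E" and fE: "f ` E \<subseteq> E"
    and B: "finite B" "B \<subseteq> carrier G" "\<And>x. x \<in> E \<Longrightarrow> \<exists>b\<in>B. f x = b \<otimes> x"
  obtains m P g where "fin_partition E m P" "\<forall>i<m. g i \<in> carrier G"
    "disjoint_family_on (\<lambda>i. g i <# P i) {..<m}" "\<And>i. i < m \<Longrightarrow> g i <# P i \<subseteq> f ` E"
proof -
  obtain g where g: "bij_betw g {..<card B} B"
    using ex_bij_betw_nat_finite[OF B(1)] by (auto simp: atLeast0LessThan)
  then have gB: "g i \<in> B" if "i < card B" for i using that by (auto simp: bij_betw_def)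
  define P where "P = (\<lambda>i. {x \<in> E. f x = g i \<otimes> x})"
  have image: "g i <# P i = f ` P i" for i
  proof -
    have "g i <# P i = (\<lambda>x. g i \<otimes> x) ` P i" by (auto simp: l_coset_def)
    also have "\<dots> = f ` P i" by (rule image_cong) (simp_all add: P_def)
    finally show ?thesis .
  qed
  have P_disj: "disjoint_family_on P {..<card B}"
    unfolding disjoint_family_on_def
  proof (intro ballI impI)
    fix i j assume ij: "i \<in> {..<card B}" "j \<in> {..<card B}" "i \<noteq> j"
    then have "g i \<noteq> g j" using g by (auto simp: bij_betw_def inj_on_def)
    moreover have "g i = g j" if "x \<in> P i" "x \<in> P j" for x
    proof -
      have "g i \<otimes> x = g j \<otimes> x" using that by (simp add: P_def)
      moreover have "x \<in> carrier G" "g i \<in> carrier G" "g j \<in> carrier G"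
        using that E gB ij B(2) by (auto simp: P_def)
      ultimately show ?thesis by simp
    qed
    ultimately show "P i \<inter> P j = {}" by auto
  qed
  show thesis
  proof
    have "x \<in> (\<Union>i<card B. P i)" if x: "x \<in> E" for x
    proof -
      obtain b where "b \<in> B" "f x = b \<otimes> x" using B(3)[OF x] by auto
      moreover from \<open>b \<in> B\<close> obtain i where "i < card B" "g i = b"
        using g by (metis bij_betw_imp_surj_on imageE lessThan_iff)
      ultimately show ?thesis using x by (auto simp: P_def)
    qed
    then show "fin_partition E (card B) P"
      using P_disj by (auto simp: fin_partition_def P_def)
    show "\<forall>i<card B. g i \<in> carrier G" using gB B(2) by auto
    show "disjoint_family_on (\<lambda>i. g i <# P i) {..<card B}"
      unfolding disjoint_family_on_def image
    proof (intro ballI impI)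
      fix i j assume "i \<in> {..<card B}" "j \<in> {..<card B}" "i \<noteq> j"
      then have "P i \<inter> P j = {}" using P_disj by (auto simp: disjoint_family_on_def)
      then show "f ` P i \<inter> f ` P j = {}"
        using inj_on_image_Int[OF inj, of "P i" "P j"] by (auto simp: P_def)
    qed
    show "g i <# P i \<subseteq> f ` E" for i
      unfolding image by (rule image_mono) (auto simp: P_def)
  qed
qed

lemma (in group) paradoxical_iff_doubling_maps:
  assumes E: "E \<subseteq> carrier G"
  shows "paradoxical G E \<longleftrightarrow> (\<exists>B f. doubling_maps G E B f)"
proof
  assume "paradoxical G E"
  then obtain m n P Q g h where
    P: "fin_partition E m P" "\<forall>i<m. g i \<in> carrier G"
      "disjoint_family_on (\<lambda>i. g i <# P i) {..<m}" and
    Q: "fin_partition E n Q" "\<forall>j<n. h j \<in> carrier G"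
      "disjoint_family_on (\<lambda>j. h j <# Q j) {..<n}" and
    PQ: "\<forall>i<m. \<forall>j<n. (g i <# P i) \<inter> (h j <# Q j) = {}" and
    sub: "\<forall>i<m. g i <# P i \<subseteq> E" "\<forall>j<n. h j <# Q j \<subseteq> E"
    unfolding paradoxical_def by (elim exE conjE) rule
  obtain f0 where f0: "\<And>x. x \<in> E \<Longrightarrow> \<exists>i<m. x \<in> P i \<and> f0 x = g i \<otimes> x" "inj_on f0 E"
    using pieces_imp_map[OF E P] by blast
  obtain f1 where f1: "\<And>x. x \<in> E \<Longrightarrow> \<exists>j<n. x \<in> Q j \<and> f1 x = h j \<otimes> x" "inj_on f1 E"
    using pieces_imp_map[OF E Q] by blast
  have im0: "\<exists>i<m. f0 x \<in> g i <# P i" and im1: "\<exists>j<n. f1 x \<in> h j <# Q j" if "x \<in> E" for x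
    using f0(1)[OF that] f1(1)[OF that] by (auto simp: l_coset_def)
  have ne: "f0 x \<noteq> f1 y" if "x \<in> E" "y \<in> E" for x y
    using im0[OF that(1)] im1[OF that(2)] PQ by (metis IntI emptyE)
  define f where "f = (\<lambda>i::nat. if i = 0 then f0 else f1)"
  define B where "B = g ` {..<m} \<union> h ` {..<n}"
  have f_E: "f i x \<in> E" if "x \<in> E" for i x
    using im0[OF that] im1[OF that] sub by (auto simp: f_def)
  have f_B: "\<exists>b\<in>B. f i x = b \<otimes> x" if "x \<in> E" for i x
    using f0(1)[OF that] f1(1)[OF that] by (auto simp: f_def B_def)
  have f_inj: "i = j \<and> x = y"
    if "x \<in> E" "y \<in> E" "i < 2" "j < 2" "f i x = f j y" for x y i j
    using that inj_onD[OF f0(2), of x y] inj_onD[OF f1(2), of x y] ne[of x y] ne[of y x]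
    by (auto simp: f_def less_2_cases_iff)
  have "finite B" "B \<subseteq> carrier G" using P(2) Q(2) by (auto simp: B_def)
  then have "doubling_maps G E B f"
    unfolding doubling_maps_def using f_E f_B f_inj by blast
  then show "\<exists>B f. doubling_maps G E B f" by blast
next
  assume "\<exists>B f. doubling_maps G E B f"
  then obtain B f where dm: "doubling_maps G E B f" by blast
  then have B: "finite B" "B \<subseteq> carrier G" by (auto simp: doubling_maps_def)
  have f: "f i x \<in> E \<and> (\<exists>b\<in>B. f i x = b \<otimes> x)" if "x \<in> E" "i < 2" for x i
    using dm that by (simp add: doubling_maps_def)
  note inj = doubling_maps_inj[OF dm]
  have half: "\<exists>m P g. fin_partition E m P \<and> (\<forall>k<m. g k \<in> carrier G) \<and>
      disjoint_family_on (\<lambda>k. g k <# P k) {..<m} \<and> (\<forall>k<m. g k <# P k \<subseteq> f i ` E)"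
    if i: "i < 2" for i
  proof -
    have "inj_on (f i) E" using inj i by (auto simp: inj_on_def)
    moreover have "f i ` E \<subseteq> E" "\<And>x. x \<in> E \<Longrightarrow> \<exists>b\<in>B. f i x = b \<otimes> x" using f i by auto
    ultimately obtain m P g where "fin_partition E m P" "\<forall>k<m. g k \<in> carrier G"
      "disjoint_family_on (\<lambda>k. g k <# P k) {..<m}" "\<And>k. k < m \<Longrightarrow> g k <# P k \<subseteq> f i ` E"
      by (rule map_imp_pieces[OF E _ _ B]) (assumption | rule that)+
    then show ?thesis by (intro exI[of _ m] exI[of _ P] exI[of _ g]) simp
  qed
  have one_less_2: "(1::nat) < 2" by simp
  obtain m P g where P: "fin_partition E m P" "\<forall>k<m. g k \<in> carrier G"
      "disjoint_family_on (\<lambda>k. g k <# P k) {..<m}" "\<forall>k<m. g k <# P k \<subseteq> f 0 ` E"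
    using half[OF pos2] by blast
  obtain n Q h where Q: "fin_partition E n Q" "\<forall>k<n. h k \<in> carrier G"
      "disjoint_family_on (\<lambda>k. h k <# Q k) {..<n}" "\<forall>k<n. h k <# Q k \<subseteq> f 1 ` E"
    using half[OF one_less_2] by blast
  have "f 0 ` E \<inter> f 1 ` E = {}" using inj[of _ _ 0 1] by auto
  then have "\<forall>i<m. \<forall>j<n. (g i <# P i) \<inter> (h j <# Q j) = {}"
    using P(4) Q(4) by (meson disjoint_iff subset_iff)
  moreover have "f 0 ` E \<subseteq> E" "f 1 ` E \<subseteq> E" using f by auto
  then have "\<forall>i<m. g i <# P i \<subseteq> E" "\<forall>j<n. h j <# Q j \<subseteq> E"
    using P(4) Q(4) by (meson subset_trans)+
  ultimately have "fin_partition E m P \<and> fin_partition E n Q \<and>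
      (\<forall>i<m. g i \<in> carrier G) \<and> (\<forall>j<n. h j \<in> carrier G) \<and>
      disjoint_family_on (\<lambda>i. g i <# P i) {..<m} \<and>
      disjoint_family_on (\<lambda>j. h j <# Q j) {..<n} \<and>
      (\<forall>i<m. \<forall>j<n. (g i <# P i) \<inter> (h j <# Q j) = {}) \<and>
      (\<forall>i<m. g i <# P i \<subseteq> E) \<and> (\<forall>j<n. h j <# Q j \<subseteq> E)"
    using P(1-3) Q(1-3) by (intro conjI)
  then show "paradoxical G E" unfolding paradoxical_def by (intro exI)
qed

section \<open>From doubling maps to a free labeling\<close>

text \<open>Acting by a binary word; like vertices of the tree, words are read from the last letter.\<close>

abbreviation act :: "(nat \<Rightarrow> 'a \<Rightarrow> 'a) \<Rightarrow> nat list \<Rightarrow> 'a \<Rightarrow> 'a" where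
  "act f u x \<equiv> foldr f u x"

lemma act_closed:
  assumes "doubling_maps G E B f" "x \<in> E"
  shows "set u \<subseteq> {..<2} \<Longrightarrow> act f u x \<in> E"
proof (induction u)
  case Nil
  then show ?case using assms(2) by simp
next
  case (Cons i u)
  then have "act f u x \<in> E" "i < 2" by auto
  then have "f i (act f u x) \<in> E" using assms(1) unfolding doubling_maps_def by blast
  then show ?case by simp
qed

lemma act_eq_same_length:
  assumes "doubling_maps G E B f" "x \<in> E" "y \<in> E"
  shows "\<lbrakk>length u = length w; set u \<subseteq> {..<2}; set w \<subseteq> {..<2}; act f u x = act f w y\<rbrakk>
    \<Longrightarrow> u = w \<and> x = y"
proof (induction u w rule: list_induct2)
  case (Cons i u j w)
  have "act f u x \<in> E" "act f w y \<in> E" using Cons.prems assms by (auto intro!: act_closed)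
  then have "i = j \<and> act f u x = act f w y"
    using Cons.prems by (intro doubling_maps_inj[OF assms(1)]) auto
  with Cons show ?case by auto
qed simp

lemma act_concat_replicate: "act f u x = x \<Longrightarrow> act f (concat (replicate n u)) x = x"
  by (induction n) auto

text \<open>
  If both \<open>f 0 x\<close> and \<open>f 1 x\<close> were periodic, then \<open>x\<close> would be fixed by a word ending in \<open>0\<close> and by a
  word ending in \<open>1\<close>; powers of the two of the same length would have to coincide.
\<close>

lemma exists_aperiodic:
  assumes dm: "doubling_maps G E B f" and "x \<in> E"
  shows "\<exists>x0\<in>E. \<forall>u. set u \<subseteq> {..<2} \<and> act f u x0 = x0 \<longrightarrow> u = []"
proof (rule ccontr)
  assume none: "\<not> ?thesis"
  have "\<exists>u. set u \<subseteq> {..<2} \<and> act f (u @ [i]) x = x" if i: "i < 2" for i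
  proof -
    have "f i x \<in> E" using dm \<open>x \<in> E\<close> i by (simp add: doubling_maps_def)
    then obtain u where "set u \<subseteq> {..<2}" "act f u (f i x) = f i x" "u \<noteq> []"
      using none by blast
    then obtain j u' where u: "u = j # u'" "set u' \<subseteq> {..<2}" "j < 2"
      and fix_u: "f j (act f u' (f i x)) = f i x"
      by (cases u) auto
    have "act f u' (f i x) \<in> E" using act_closed[OF dm \<open>f i x \<in> E\<close> u(2)] .
    then have "act f u' (f i x) = x"
      using doubling_maps_inj[OF dm _ \<open>x \<in> E\<close> u(3) i fix_u] by blast
    with u(2) show ?thesis by auto
  qed
  from this[of 0] this[of 1] obtain u w where
    u: "set u \<subseteq> {..<2}" "act f (u @ [0]) x = x" and w: "set w \<subseteq> {..<2}" "act f (w @ [1]) x = x"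
    by auto
  define a b where "a = u @ [0]" and "b = w @ [1]"
  have "concat (replicate (length b) a) = concat (replicate (length a) b)"
  proof (rule conjunct1[OF act_eq_same_length[OF dm \<open>x \<in> E\<close> \<open>x \<in> E\<close>]])
    show "length (concat (replicate (length b) a)) = length (concat (replicate (length a) b))"
      by (simp add: length_concat sum_list_replicate)
    show "set (concat (replicate (length b) a)) \<subseteq> {..<2}"
      "set (concat (replicate (length a) b)) \<subseteq> {..<2}"
      using u(1) w(1) by (auto simp: a_def b_def)
    have "act f (concat (replicate n a)) x = x" "act f (concat (replicate n b)) x = x" for n
      unfolding a_def b_def using act_concat_replicate[OF u(2)] act_concat_replicate[OF w(2)]
      by auto
    then show "act f (concat (replicate (length b) a)) x = act f (concat (replicate (length a) b)) x"
      by simp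
  qed
  moreover have last_power: "last (concat (replicate (Suc n) c)) = last c" if "c \<noteq> []" for n and c :: "nat list"
    using that by (induction n) auto
  ultimately have "last a = last b"
    using last_power[of a "length w"] last_power[of b "length u"] by (simp add: a_def b_def)
  then show False by (simp add: a_def b_def)
qed

lemma act_inj_at_aperiodic:
  assumes dm: "doubling_maps G E B f" and "x0 \<in> E"
    and aper: "\<And>u. set u \<subseteq> {..<2} \<Longrightarrow> act f u x0 = x0 \<Longrightarrow> u = []"
  shows "\<lbrakk>set u \<subseteq> {..<2}; set w \<subseteq> {..<2}; act f u x0 = act f w x0\<rbrakk> \<Longrightarrow> u = w"
proof (induction u arbitrary: w)
  case Nil
  then show ?case using aper[of w] by simp
next
  case (Cons i u)
  show ?case
  proof (cases w)
    case Nil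
    then show ?thesis using Cons.prems aper[of "i # u"] by simp
  next
    case (Cons j w')
    have "act f u x0 \<in> E" "act f w' x0 \<in> E"
      using Cons.prems Cons act_closed[OF dm \<open>x0 \<in> E\<close>] by auto
    then have "i = j \<and> act f u x0 = act f w' x0"
      using Cons.prems Cons by (intro doubling_maps_inj[OF dm]) auto
    with Cons.prems Cons show ?thesis using Cons.IH[of w'] by auto
  qed
qed

text \<open>
  An embedding of the trivalent tree into the binary tree: the three children of the root go to the
  pairwise incomparable words \<open>0\<close>, \<open>01\<close>, \<open>11\<close>, and every later step is copied.
\<close>

primrec binary_word :: "nat list \<Rightarrow> nat list" where
  "binary_word [] = []"
| "binary_word (i # v) =
    (if v = [] then (if i = 0 then [0] else if i = 1 then [0, 1] else [1, 1])
     else i # binary_word v)"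

lemma binary_word_binary: "trivalent_vertex v \<Longrightarrow> set (binary_word v) \<subseteq> {..<2}"
  by (induction v) (auto split: if_splits)

lemma binary_word_eq_Nil_iff [simp]: "binary_word v = [] \<longleftrightarrow> v = []"
  by (cases v) auto

lemma binary_word_inj:
  "\<lbrakk>trivalent_vertex v; trivalent_vertex w; binary_word v = binary_word w\<rbrakk> \<Longrightarrow> v = w"
proof (induction v arbitrary: w)
  case Nil
  then show ?case by (metis binary_word_eq_Nil_iff)
next
  case (Cons i v)
  \<comment> \<open>No vertex goes to the word \<open>1\<close>, so \<open>01\<close> and \<open>11\<close> are not reached by a copied step.\<close>
  have short: "binary_word u \<noteq> [1]" for u
    by (cases u) auto
  obtain j w' where w: "w = j # w'"
    using Cons.prems(3) by (metis binary_word_eq_Nil_iff neq_Nil_conv)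
  show ?case
    using Cons.prems Cons.IH[of w'] short[of v] short[of w', symmetric]
    by (auto simp: w split: if_splits)
qed

text \<open>
  A vertex at the word \<open>u\<close> is placed at the point \<open>u x\<^sub>0\<close>, and an edge is labeled by the translation
  between the points at its ends; the path product of \<open>v\<close> is then the translation from \<open>x\<^sub>0\<close> to the
  point at \<open>v\<close>.
\<close>

lemma (in group) doubling_maps_imp_free_labeling:
  assumes E: "E \<subseteq> carrier G" "E \<noteq> {}" and dm: "doubling_maps G E B f"
  obtains A l where "label_set G A" "free_labeling G A l"
proof -
  have B: "finite B" "B \<subseteq> carrier G"
    and fB: "\<And>x i. x \<in> E \<Longrightarrow> i < 2 \<Longrightarrow> \<exists>b\<in>B. f i x = b \<otimes> x"
    using dm by (auto simp: doubling_maps_def)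
  obtain x0 where x0: "x0 \<in> E" and aper: "\<And>u. set u \<subseteq> {..<2} \<Longrightarrow> act f u x0 = x0 \<Longrightarrow> u = []"
    using exists_aperiodic[OF dm] E(2) by blast
  define z where "z = (\<lambda>v. act f (binary_word v) x0)"
  define l where "l = (\<lambda>v. z v \<otimes> inv (z (tl v)))"
  have zE: "z v \<in> E" if "trivalent_vertex v" for v
    unfolding z_def using act_closed[OF dm x0 binary_word_binary[OF that]] .
  have zG: "z v \<in> carrier G" if "trivalent_vertex v" for v
    using zE[OF that] E(1) by auto
  have x0G: "x0 \<in> carrier G" using x0 E(1) by auto
  \<comment> \<open>The steps from the root need not be translations from \<open>B\<close>, but there are only three of them.\<close>
  define C where "C = insert \<one> (B \<union> (\<lambda>i. l [i]) ` {..<3})"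
  define A where "A = C \<union> m_inv G ` C"
  have lG: "l v \<in> carrier G" if "trivalent_vertex v" for v
    using zG[OF that] zG[OF trivalent_vertex_suffix[OF that], of "tl v"] by (simp add: l_def suffix_tl)
  have C: "finite C" "C \<subseteq> carrier G" "\<one> \<in> C"
    using B lG by (auto simp: C_def)
  have "label_set G A"
    unfolding label_set_def
  proof (intro conjI)
    show "A \<subseteq> carrier G" "finite A" "\<one> \<in> A" using C by (auto simp: A_def)
    have "m_inv G ` m_inv G ` C = C"
      using C(2) by (force simp: image_image)
    moreover have "set_inv A = m_inv G ` A" by (auto simp: SET_INV_def)
    ultimately show "set_inv A = A" by (auto simp: A_def image_Un)
  qed
  moreover have "l v \<in> A" if v: "trivalent_vertex v" "v \<noteq> []" for v
  proof -
    obtain i w where w: "v = i # w" using v(2) by (cases v) auto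
    show ?thesis
    proof (cases "w = []")
      case True
      then show ?thesis using v w by (auto simp: A_def C_def)
    next
      case False
      then have i: "i < 2" "trivalent_vertex w" using v w by auto
      obtain b where b: "b \<in> B" "f i (z w) = b \<otimes> z w" using fB[OF zE[OF i(2)] i(1)] by auto
      have "z v = b \<otimes> z w" using b(2) False by (simp add: z_def w)
      then have "l v = b" using b(1) B(2) zG[OF i(2)] by (auto simp: l_def w m_assoc)
      then show ?thesis using b by (auto simp: A_def C_def)
    qed
  qed
  moreover have path: "path_product G l v = z v \<otimes> inv x0" if "trivalent_vertex v" for v
    using that
  proof (induction v)
    case Nil
    then show ?case using x0G by (simp add: z_def)
  next
    case (Cons i v)
    have v: "trivalent_vertex v" using Cons.prems by simp
    have "path_product G l (i # v) = z (i # v) \<otimes> inv (z v) \<otimes> (z v \<otimes> inv x0)"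
      using Cons.IH[OF v] by (simp add: l_def)
    moreover have "inv (z v) \<otimes> (z v \<otimes> inv x0) = inv x0"
      using zG[OF v] x0G by (simp flip: m_assoc)
    ultimately show ?case using zG[OF Cons.prems] zG[OF v] x0G by (simp add: m_assoc)
  qed
  moreover have "path_product G l v \<noteq> path_product G l w"
    if vw: "trivalent_vertex v" "trivalent_vertex w" "incomparable v w" for v w
  proof
    assume "path_product G l v = path_product G l w"
    then have "z v = z w" using path vw zG x0G by simp
    then have "binary_word v = binary_word w"
      unfolding z_def using binary_word_binary vw
      by (intro act_inj_at_aperiodic[OF dm x0 aper]) auto
    then have "v = w" using binary_word_inj vw by auto
    with vw(3) show False by (simp add: incomparable_def)
  qed
  ultimately show thesis using that[of A l] unfolding free_labeling_def by blast
qed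

section \<open>From a free labeling to doubling maps\<close>

text \<open>
  A fibre is a chain.  Choosing for each of its vertices a child off the chain gives an antichain
  whose path products are distinct elements of the finite set \<open>A x\<close>.
\<close>

lemma (in group) free_labeling_fibre_finite:
  assumes A: "finite A" and l: "free_labeling G A l"
  shows "finite {v. trivalent_vertex v \<and> path_product G l v = x}" (is "finite ?C")
proof -
  have chain: "suffix u w \<or> suffix w u" if "u \<in> ?C" "w \<in> ?C" for u w
    using that l by (auto simp: free_labeling_def incomparable_def)
  \<comment> \<open>A chain passes through at most one child of any given vertex.\<close>
  have "\<exists>j<2. \<forall>w\<in>?C. \<not> suffix (j # u) w" for u
  proof (rule ccontr)
    assume "\<not> ?thesis"
    then have meets: "\<exists>w\<in>?C. suffix (j # u) w" if "j < 2" for j using that by blast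
    obtain w0 w1 where w: "w0 \<in> ?C" "w1 \<in> ?C" "suffix (0 # u) w0" "suffix (1 # u) w1"
      using meets[of 0] meets[of 1] by auto
    then have "suffix (0 # u) w1 \<and> suffix (1 # u) w1 \<or> suffix (0 # u) w0 \<and> suffix (1 # u) w0"
      using chain[of w0 w1] suffix_order.trans by blast
    then show False using suffix_Cons_unique[of 0 u _ 1] by auto
  qed
  then obtain c where c: "\<And>u. c u < (2::nat)" "\<And>u w. w \<in> ?C \<Longrightarrow> \<not> suffix (c u # u) w"
    by metis
  have triv: "trivalent_vertex (c u # u)" if "u \<in> ?C" for u
    using that c(1)[of u] by auto
  have off: "incomparable (c u # u) (c w # w)" if "u \<in> ?C" "w \<in> ?C" "u \<noteq> w" "suffix u w" for u w
  proof -
    have "length u < length w"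
      using that by (auto simp: suffix_def)
    then have "\<not> suffix (c w # w) (c u # u)" using suffix_length_le by fastforce
    moreover have "\<not> suffix (c u # u) (c w # w)"
      using c(2)[OF that(2), of u] that(3) by (auto simp: suffix_Cons)
    ultimately show ?thesis by (simp add: incomparable_def)
  qed
  have "inj_on (\<lambda>u. path_product G l (c u # u)) ?C"
  proof (rule inj_onI, rule ccontr)
    fix u w
    assume uw: "u \<in> ?C" "w \<in> ?C" "path_product G l (c u # u) = path_product G l (c w # w)" "u \<noteq> w"
    then have "incomparable (c u # u) (c w # w)"
      using chain[OF uw(1,2)] off[OF uw(1,2)] off[OF uw(2,1)] by (auto simp: incomparable_def)
    with l triv[OF uw(1)] triv[OF uw(2)] uw(3) show False unfolding free_labeling_def by blast
  qed
  moreover have "(\<lambda>u. path_product G l (c u # u)) ` ?C \<subseteq> (\<lambda>a. a \<otimes> x) ` A"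
    using l triv by (auto simp: free_labeling_def)
  ultimately show ?thesis
    using finite_subset[OF _ finite_imageI[OF A]] by (blast intro: finite_imageD)
qed

text \<open>
  Vertices of the binary tree obtained by alternating a step to a child with a jump \<open>L\<close>, which below
  sends a vertex to the deepest vertex with the same path product.
\<close>

primrec jump_vertex :: "(nat list \<Rightarrow> nat list) \<Rightarrow> nat list \<Rightarrow> nat list" where
  "jump_vertex L [] = L []"
| "jump_vertex L (i # b) = L (i # jump_vertex L b)"

lemma jump_vertex_trivalent:
  assumes "\<And>v. trivalent_vertex v \<Longrightarrow> trivalent_vertex (L v)"
  shows "set b \<subseteq> {..<2} \<Longrightarrow> trivalent_vertex (jump_vertex L b)"
proof (induction b)
  case Nil
  then show ?case using assms[of "[]"] by simp
next
  case (Cons i b)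
  then have "trivalent_vertex (i # jump_vertex L b)" by simp
  from assms[OF this] show ?case by simp
qed

lemma jump_vertex_suffix:
  assumes "\<And>v. trivalent_vertex v \<Longrightarrow> trivalent_vertex (L v) \<and> suffix v (L v)"
    and "set (d @ i # b) \<subseteq> {..<2}"
  shows "suffix (i # jump_vertex L b) (jump_vertex L (d @ i # b))"
proof -
  have below: "suffix (j # jump_vertex L c) (jump_vertex L (j # c))" if "set (j # c) \<subseteq> {..<2}" for j c
  proof -
    have "trivalent_vertex (jump_vertex L c)"
      using conjunct1[OF assms(1)] that by (intro jump_vertex_trivalent) simp_all
    then have "trivalent_vertex (j # jump_vertex L c)" using that by simp
    from assms(1)[OF this] show ?thesis by simp
  qed
  show ?thesis
    using assms(2)
  proof (induction d)
    case Nil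
    then show ?case using below[of i b] by simp
  next
    case (Cons j d)
    have "suffix (i # jump_vertex L b) (jump_vertex L (d @ i # b))" using Cons by simp
    moreover have "suffix (j # jump_vertex L (d @ i # b)) (jump_vertex L ((j # d) @ i # b))"
      using below[of j "d @ i # b"] Cons.prems by simp
    ultimately show ?case by (meson suffix_ConsD suffix_order.trans)
  qed
qed

lemma jump_vertex_inj:
  assumes L: "\<And>v. trivalent_vertex v \<Longrightarrow> trivalent_vertex (L v) \<and> suffix v (L v)"
    and "set b \<subseteq> {..<2}" "set b' \<subseteq> {..<2}" "jump_vertex L b = jump_vertex L b'"
  shows "b = b'"
proof (rule ccontr)
  assume "b \<noteq> b'"
  have no_suffix: False
    if "suffix b b'" "b \<noteq> b'" "set b' \<subseteq> {..<2}" "jump_vertex L b = jump_vertex L b'" for b b'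
  proof -
    obtain d where "b' = d @ b" "d \<noteq> []" using \<open>suffix b b'\<close> \<open>b \<noteq> b'\<close> by (auto simp: suffix_def)
    then obtain d' i where "b' = d' @ i # b" by (cases d rule: rev_cases) auto
    then have "suffix (i # jump_vertex L b) (jump_vertex L b)"
      using jump_vertex_suffix[OF L, of d' i b] that by auto
    then show False using suffix_length_le by fastforce
  qed
  have "\<not> suffix b b'" "\<not> suffix b' b"
    using no_suffix[of b b'] no_suffix[of b' b] \<open>b \<noteq> b'\<close> assms by auto
  then have "rev b \<parallel> rev b'" by (simp add: parallel_def suffix_to_prefix)
  then obtain c i d j d' where "i \<noteq> j" "rev b = c @ i # d" "rev b' = c @ j # d'"
    using parallel_decomp by blast
  then have split: "b = rev d @ i # rev c" "b' = rev d' @ j # rev c"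
    by (simp_all add: rev_swap)
  have i: "suffix (i # jump_vertex L (rev c)) (jump_vertex L b)"
    using jump_vertex_suffix[OF L, of "rev d" i "rev c", folded split(1)] assms(2) by blast
  have "suffix (j # jump_vertex L (rev c)) (jump_vertex L b')"
    using jump_vertex_suffix[OF L, of "rev d'" j "rev c", folded split(2)] assms(3) by blast
  then have j: "suffix (j # jump_vertex L (rev c)) (jump_vertex L b)"
    by (simp only: assms(4))
  from suffix_Cons_unique[OF i j] \<open>i \<noteq> j\<close> show False by simp
qed

text \<open>
  With \<open>q b\<close> the path product at the vertex reached by the binary word \<open>b\<close>, the maps are
  \<open>q b \<mapsto> q (i # b)\<close>.
\<close>

lemma (in group) free_labeling_imp_doubling_maps:
  assumes A: "label_set G A" and l: "free_labeling G A l"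
  obtains E f where "E \<subseteq> carrier G" "E \<noteq> {}" "doubling_maps G E A f"
proof -
  let ?p = "path_product G l"
  have fin: "finite A" and sub: "A \<subseteq> carrier G" using A by (auto simp: label_set_def)
  have lA: "l v \<in> A" if "trivalent_vertex v" "v \<noteq> []" for v
    using l that by (auto simp: free_labeling_def)
  have pG: "?p v \<in> carrier G" if "trivalent_vertex v" for v
    using path_product_closed[OF is_group sub] lA trivalent_vertex_suffix[OF that] by blast
  have "\<exists>w. trivalent_vertex w \<and> ?p w = ?p v \<and>
      (\<forall>u. trivalent_vertex u \<and> ?p u = ?p v \<longrightarrow> suffix u w)" if v: "trivalent_vertex v" for v
  proof -
    let ?C = "{u. trivalent_vertex u \<and> ?p u = ?p v}"
    have "finite ?C" by (rule free_labeling_fibre_finite[OF fin l])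
    then have fin_len: "finite (length ` ?C)" by (rule finite_imageI)
    have "length ` ?C \<noteq> {}" using v by auto
    from Max_in[OF fin_len this] obtain w where w: "w \<in> ?C" "length w = Max (length ` ?C)"
      by (metis (no_types, lifting) imageE)
    have max: "length u \<le> length w" if "u \<in> ?C" for u
      unfolding w(2) using fin_len that by (intro Max_ge imageI)
    have "suffix u w" if u: "u \<in> ?C" for u
    proof -
      have "suffix u w \<or> suffix w u" using u w l unfolding free_labeling_def incomparable_def by auto metis
      then show ?thesis using max[OF u] by (auto simp: suffix_def)
    qed
    with w show ?thesis by auto
  qed
  then obtain L where L: "\<And>v. trivalent_vertex v \<Longrightarrow> trivalent_vertex (L v) \<and> ?p (L v) = ?p v \<and>
      (\<forall>u. trivalent_vertex u \<and> ?p u = ?p v \<longrightarrow> suffix u (L v))"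
    by metis
  then have L': "\<And>v. trivalent_vertex v \<Longrightarrow> trivalent_vertex (L v) \<and> suffix v (L v)" by blast
  define \<phi> where "\<phi> = jump_vertex L"
  define W where "W = {b. set b \<subseteq> {..<2::nat}}"
  define q where "q = (\<lambda>b. ?p (\<phi> b))"
  have triv: "trivalent_vertex (\<phi> b)" if "b \<in> W" for b
    using that L' jump_vertex_trivalent[of L b] by (auto simp: W_def \<phi>_def)
  have deepest: "suffix u (\<phi> b)" if b: "b \<in> W" and u: "trivalent_vertex u" "?p u = q b" for b u
  proof -
    obtain v where v: "trivalent_vertex v" "\<phi> b = L v"
    proof (cases b)
      case Nil
      then show ?thesis using that[of "[]"] by (simp add: \<phi>_def)
    next
      case (Cons i c)
      have "trivalent_vertex (i # \<phi> c)" using b Cons triv[of c] by (auto simp: W_def)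
      then show ?thesis using that[of "i # \<phi> c"] Cons by (simp add: \<phi>_def)
    qed
    then show ?thesis using L[OF v(1)] u by (auto simp: q_def)
  qed
  have q_inj: "inj_on q W"
  proof (rule inj_onI)
    fix b c assume bc: "b \<in> W" "c \<in> W" "q b = q c"
    have "suffix (\<phi> b) (\<phi> c)" "suffix (\<phi> c) (\<phi> b)"
      using bc deepest[of c "\<phi> b"] deepest[of b "\<phi> c"] triv by (auto simp: q_def)
    then have "\<phi> b = \<phi> c" by (rule suffix_order.antisym)
    then show "b = c" using jump_vertex_inj[OF L'] bc by (auto simp: \<phi>_def W_def)
  qed
  have step: "\<exists>a\<in>A. q (i # b) = a \<otimes> q b" if "i < 2" "b \<in> W" for i b
  proof -
    have "trivalent_vertex (i # \<phi> b)" using that triv[of b] by auto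
    then show ?thesis using L[of "i # \<phi> b"] lA[of "i # \<phi> b"] by (auto simp: q_def \<phi>_def)
  qed
  define f where "f = (\<lambda>i x. q (i # the_inv_into W q x))"
  have f: "f i (q b) = q (i # b)" if "b \<in> W" for i b
    using that by (simp add: f_def the_inv_into_f_f[OF q_inj])
  have W: "i # b \<in> W" if "i < 2" "b \<in> W" for i b
    using that by (auto simp: W_def)
  have "doubling_maps G (q ` W) A f"
    unfolding doubling_maps_def
  proof (intro conjI ballI allI impI)
    show "finite A" "A \<subseteq> carrier G" by fact+
  next
    fix x and i :: nat assume x: "x \<in> q ` W" and i: "i < 2"
    then obtain b where b: "b \<in> W" "x = q b" by auto
    show "f i x \<in> q ` W" using b W[OF i] by (simp add: f)
    show "\<exists>a\<in>A. f i x = a \<otimes> x" using b step[OF i] by (simp add: f)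
  next
    fix x y and i j :: nat
    assume xy: "x \<in> q ` W" "y \<in> q ` W" and ij: "i < 2" "j < 2" and eq: "f i x = f j y"
    from xy obtain b c where bc: "b \<in> W" "x = q b" "c \<in> W" "y = q c" by auto
    then have "q (i # b) = q (j # c)" using eq by (simp add: f)
    then have "i # b = j # c" using inj_onD[OF q_inj] W bc ij by blast
    then show "i = j" "x = y" using bc by auto
  qed
  moreover have "q ` W \<subseteq> carrier G" using pG triv by (auto simp: q_def)
  moreover have "q ` W \<noteq> {}" by (auto simp: W_def intro: exI[of _ "[]"])
  ultimately show thesis using that by blast
qed

section \<open>Supramenability and collision rank\<close>

theorem proposition6p2:
  fixes G :: "('a, 'b) monoid_scheme"
  assumes "group G"
  shows "supramenable G \<longleftrightarrow> collision_rank G \<le> 1"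
proof -
  interpret group G by fact
  have "\<not> supramenable G \<longleftrightarrow> (\<exists>E. E \<subseteq> carrier G \<and> E \<noteq> {} \<and> paradoxical G E)"
    unfolding supramenable_def by blast
  also have "\<dots> \<longleftrightarrow> (\<exists>E B f. E \<subseteq> carrier G \<and> E \<noteq> {} \<and> doubling_maps G E B f)"
    by (simp add: paradoxical_iff_doubling_maps cong: conj_cong)
  also have "\<dots> \<longleftrightarrow> (\<exists>A l. label_set G A \<and> free_labeling G A l)"
    by (meson doubling_maps_imp_free_labeling free_labeling_imp_doubling_maps)
  also have "\<dots> \<longleftrightarrow> \<not> collision_rank G \<le> 1"
    unfolding collision_rank_le_1_iff[OF assms]
    using collides_one_iff_no_free_labeling[OF assms] by blast
  finally show ?thesis by blast
qed

end
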